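(* Let $H_3$ be the Heisenberg group with its canonical metric and consider the Lorentz force $F_{e_1,\rho}$ with $\rho\ne0$. Let $\lambda=\exp(x_1e_1+y_1e_2+z_1e_3)\in H_3$ with $(x_1,y_1,z_1)\ne(0,0,0)$, and let $\mathcal E>0$. (a) If $x_1\ne0$ or $y_1=0$, then there does not exist any $\lambda$-periodic magnetic trajectory for $F_{e_1,\rho}$. (b) If $x_1=0$ and $y_1\ne0$, then there exist $\lambda$-periodic magnetic trajectories for $F_{e_1,\rho}$ with energy $\mathcal E$.
   Context: The Heisenberg group $H_3$ is $\mathbb{R}^3$ with product $(x_1,y_1,z_1)(x_2,y_2,z_2)=(x_1+x_2,\,y_1+y_2,\,z_1+z_2+\tfrac12(x_1y_2-x_2y_1))$. Its Lie algebra has basis of left-invariant fields $e_1=\partial_x-\tfrac12 y\,\partial_z$, $e_2=\partial_y+\tfrac12 x\,\partial_z$, $e_3=\partial_z$, with $[e_1,e_2]=e_3$; $\exp(xe_1+ye_2+ze_3)=(x,y,z)$. The canonical metric is the left-invariant metric for which $e_1,e_2,e_3$ is orthonormal. For $\rho\in\mathbb{R}$, $F_{e_1,\rho}$ is the left-invariant skew-symmetric $(1,1)$-tensor with $F e_1=\rho e_2+e_3$, $F e_2=-\rho e_1$, $F e_3=-e_1$. A magnetic trajectory is a curve $\gamma:\mathbb{R}\to H_3$ with $\nabla_{\gamma'}\gamma'=F\gamma'$; its energy is $\tfrac12|\gamma'(0)|^2$. For $\lambda\in H_3$ different from the identity, a curve $\sigma:\mathbb{R}\to H_3$ is $\lambda$-periodic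 if there is $\omega\ne0$ (a period) with $\lambda\sigma(t)=\sigma(t+\omega)$ for all $t\in\mathbb{R}$. Trajectories are not required to pass through the identity. *)

theory Defs
  imports "HOL-Analysis.Analysis"
begin

section \<open>Riemannian geometry in a global chart of \<open>\<real>\<^sup>n\<close>\<close>

text \<open>A metric is given by the inner products \<open>g p v w\<close> of tangent vectors \<open>v, w\<close> at \<open>p\<close>.\<close>

type_synonym 'n metric = "real^'n \<Rightarrow> real^'n \<Rightarrow> real^'n \<Rightarrow> real"

definition gram :: "'n::finite metric \<Rightarrow> real^'n \<Rightarrow> real^'n^'n" where
  "gram g p = (\<chi> i j. g p (axis i 1) (axis j 1))"

definition partial :: "'n::finite \<Rightarrow> (real^'n \<Rightarrow> real) \<Rightarrow> real^'n \<Rightarrow> real" where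
  "partial i f p = frechet_derivative f (at p) (axis i 1)"

text \<open>The Christoffel symbols \<open>\<Gamma>\<^sup>k\<^sub>i\<^sub>j\<close> of the Levi-Civita connection.\<close>

definition christoffel :: "'n::finite metric \<Rightarrow> real^'n \<Rightarrow> 'n \<Rightarrow> 'n \<Rightarrow> 'n \<Rightarrow> real" where
  "christoffel g p k i j =
     (\<Sum>l\<in>UNIV. matrix_inv (gram g p) $ k $ l *
        (partial i (\<lambda>q. gram g q $ j $ l) p + partial j (\<lambda>q. gram g q $ i $ l) p
          - partial l (\<lambda>q. gram g q $ i $ j) p)) / 2"

definition velocity :: "(real \<Rightarrow> 'a::real_normed_vector) \<Rightarrow> real \<Rightarrow> 'a" where
  "velocity \<gamma> t = vector_derivative \<gamma> (at t)"

definition smooth_curve :: "(real \<Rightarrow> 'a::real_normed_vector) \<Rightarrow> bool" where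
  "smooth_curve \<gamma> \<longleftrightarrow> (\<forall>n t. (velocity ^^ n) \<gamma> differentiable (at t))"

text \<open>The covariant derivative \<open>\<nabla>\<^bsub>\<gamma>'\<^esub>\<gamma>'\<close> along the curve.\<close>

definition covariant_acceleration ::
    "'n::finite metric \<Rightarrow> (real \<Rightarrow> real^'n) \<Rightarrow> real \<Rightarrow> real^'n" where
  "covariant_acceleration g \<gamma> t =
     (\<chi> k. velocity (velocity \<gamma>) t $ k +
        (\<Sum>i\<in>UNIV. \<Sum>j\<in>UNIV.
           christoffel g (\<gamma> t) k i j * velocity \<gamma> t $ i * velocity \<gamma> t $ j))"

section \<open>The Heisenberg group\<close>

definition heis_mult :: "real^3 \<Rightarrow> real^3 \<Rightarrow> real^3" where
  "heis_mult p q =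
     vector [p$1 + q$1, p$2 + q$2, p$3 + q$3 + (p$1 * q$2 - q$1 * p$2) / 2]"

lemma heis_mult_nth:
  "heis_mult p q $ 1 = p$1 + q$1" "heis_mult p q $ 2 = p$2 + q$2"
  "heis_mult p q $ 3 = p$3 + q$3 + (p$1 * q$2 - q$1 * p$2) / 2"
  by (simp_all add: heis_mult_def)

lemma heis_mult_assoc: "heis_mult (heis_mult p q) r = heis_mult p (heis_mult q r)"
  by (simp add: vec_eq_iff forall_3 heis_mult_nth field_simps)

lemma heis_mult_zero: "heis_mult 0 p = p" "heis_mult p 0 = p"
  by (simp_all add: vec_eq_iff forall_3 heis_mult_nth)

lemma heis_mult_minus: "heis_mult (- p) p = 0" "heis_mult p (- p) = 0"
  by (simp_all add: vec_eq_iff forall_3 heis_mult_nth)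

definition heis_e1 :: "real^3 \<Rightarrow> real^3" where
  "heis_e1 p = vector [1, 0, - (p$2) / 2]"

definition heis_e2 :: "real^3 \<Rightarrow> real^3" where
  "heis_e2 p = vector [0, 1, p$1 / 2]"

definition heis_e3 :: "real^3 \<Rightarrow> real^3" where
  "heis_e3 p = vector [0, 0, 1]"

lemmas heis_e_defs = heis_e1_def heis_e2_def heis_e3_def

lemma heis_mult_has_derivative:
  "(heis_mult p has_derivative
     (\<lambda>v. vector [v$1, v$2, v$3 + (p$1 * v$2 - v$1 * p$2) / 2])) (at q)"
proof -
  have "(heis_mult p has_derivative
          (\<lambda>v. heis_mult p v - p)) (at q)"
  proof -
    have lin: "bounded_linear (\<lambda>v. heis_mult p v - p)"
    proof (rule linear_conv_bounded_linear[THEN iffD1], rule linearI)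
      show "heis_mult p (a + b) - p = (heis_mult p a - p) + (heis_mult p b - p)" for a b
        by (simp add: vec_eq_iff forall_3 heis_mult_nth field_simps)
      show "heis_mult p (r *\<^sub>R a) - p = r *\<^sub>R (heis_mult p a - p)" for r a
        by (simp add: vec_eq_iff forall_3 heis_mult_nth field_simps)
    qed
    have "((\<lambda>v. (heis_mult p v - p) + p) has_derivative (\<lambda>v. (heis_mult p v - p) + 0)) (at q)"
      by (intro has_derivative_add bounded_linear_imp_has_derivative[OF lin]
            has_derivative_const)
    then show ?thesis by simp
  qed
  moreover have "heis_mult p v - p = vector [v$1, v$2, v$3 + (p$1 * v$2 - v$1 * p$2) / 2]" for v
    by (simp add: vec_eq_iff forall_3 heis_mult_nth)
  ultimately show ?thesis by simp
qed

lemma heis_e_left_invariant: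
  "frechet_derivative (heis_mult p) (at q) (heis_e1 q) = heis_e1 (heis_mult p q)"
  "frechet_derivative (heis_mult p) (at q) (heis_e2 q) = heis_e2 (heis_mult p q)"
  "frechet_derivative (heis_mult p) (at q) (heis_e3 q) = heis_e3 (heis_mult p q)"
  by (simp_all add: frechet_derivative_at[OF heis_mult_has_derivative, symmetric]
        vec_eq_iff forall_3 heis_mult_nth heis_e_defs field_simps)

text \<open>The exponential of a left-invariant field is the time-one value of its integral curve
  through the identity \<open>0\<close>.\<close>

definition heis_exp :: "(real^3 \<Rightarrow> real^3) \<Rightarrow> real^3" where
  "heis_exp X = (THE p. \<exists>c. c 0 = 0 \<and>
     (\<forall>t. (c has_vector_derivative X (c t)) (at t)) \<and> c 1 = p)"

lemma heis_exp_eq: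
  "heis_exp (\<lambda>p. x *\<^sub>R heis_e1 p + y *\<^sub>R heis_e2 p + z *\<^sub>R heis_e3 p) = vector [x, y, z]"
proof -
  let ?X = "\<lambda>p. x *\<^sub>R heis_e1 p + y *\<^sub>R heis_e2 p + z *\<^sub>R heis_e3 p"
  let ?w = "vector [x, y, z] :: real^3"
  have line: "f t = t * k" if "\<And>t. (f has_vector_derivative k) (at t)" "f 0 = 0"
    for f :: "real \<Rightarrow> real" and k t
  proof -
    have "((\<lambda>t. f t - t *\<^sub>R k) has_vector_derivative 0) (at s within UNIV)" for s
      using that(1)[of s] by (auto intro!: derivative_eq_intros)
    then obtain a where a: "\<And>s. f s - s *\<^sub>R k = a"
      by (rule has_vector_derivative_zero_constant[OF convex_UNIV]) auto
    from a[of t] a[of 0] that(2) show ?thesis by simp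
  qed
  have comp: "((\<lambda>t. c t $ i) has_vector_derivative D $ i) (at t)"
    if "(c has_vector_derivative D) (at t)" for c :: "real \<Rightarrow> real^3" and D t i
    using bounded_linear.has_vector_derivative[OF bounded_linear_vec_nth that] .
  have uniq: "p = ?w" if c: "c 0 = 0" "\<And>t. (c has_vector_derivative ?X (c t)) (at t)" "c 1 = p"
    for c p
  proof -
    have 1: "c t $ 1 = t * x" for t
    proof (rule line)
      show "((\<lambda>t. c t $ 1) has_vector_derivative x) (at s)" for s
        using comp[OF c(2)[of s], of 1] by (simp add: heis_e_defs)
    qed (simp add: c(1))
    have 2: "c t $ 2 = t * y" for t
    proof (rule line)
      show "((\<lambda>t. c t $ 2) has_vector_derivative y) (at s)" for s
        using comp[OF c(2)[of s], of 2] by (simp add: heis_e_defs)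
    qed (simp add: c(1))
    have 3: "c t $ 3 = t * z" for t
    proof (rule line)
      show "((\<lambda>t. c t $ 3) has_vector_derivative z) (at s)" for s
        using comp[OF c(2)[of s], of 3] by (simp add: heis_e_defs 1 2 mult_ac)
    qed (simp add: c(1))
    show ?thesis
      using 1[of 1] 2[of 1] 3[of 1] by (simp add: vec_eq_iff forall_3 flip: c(3))
  qed
  have X: "?X (t *\<^sub>R ?w) = ?w" for t
    by (simp add: vec_eq_iff forall_3 heis_e_defs)
  have "((\<lambda>t. t *\<^sub>R ?w) has_vector_derivative ?X (t *\<^sub>R ?w)) (at t)" for t
    unfolding X by (auto intro!: derivative_eq_intros)
  then show ?thesis
    unfolding heis_exp_def
    by (intro the_equality exI[of _ "\<lambda>t. t *\<^sub>R ?w"]) (auto intro: uniq)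
qed

text \<open>The components of a tangent vector at \<open>p\<close> in the frame \<open>e\<^sub>1, e\<^sub>2, e\<^sub>3\<close>.\<close>

definition frame_coords :: "real^3 \<Rightarrow> real^3 \<Rightarrow> real^3" where
  "frame_coords p v = vector [v$1, v$2, v$3 + (p$2 * v$1 - p$1 * v$2) / 2]"

lemma frame_coords_iff:
  "v = a *\<^sub>R heis_e1 p + b *\<^sub>R heis_e2 p + c *\<^sub>R heis_e3 p \<longleftrightarrow> frame_coords p v = vector [a, b, c]"
  by (auto simp: vec_eq_iff forall_3 heis_e_defs frame_coords_def field_simps)

definition heis_metric :: "3 metric" where
  "heis_metric p v w = frame_coords p v \<bullet> frame_coords p w"

lemma heis_metric_orthonormal:
  "heis_metric p (heis_e1 p) (heis_e1 p) = 1" "heis_metric p (heis_e2 p) (heis_e2 p) = 1"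
  "heis_metric p (heis_e3 p) (heis_e3 p) = 1" "heis_metric p (heis_e1 p) (heis_e2 p) = 0"
  "heis_metric p (heis_e1 p) (heis_e3 p) = 0" "heis_metric p (heis_e2 p) (heis_e3 p) = 0"
  by (simp_all add: heis_metric_def frame_coords_def heis_e_defs inner_vec_def sum_3)

definition lorentz_e1 :: "real \<Rightarrow> real^3 \<Rightarrow> real^3 \<Rightarrow> real^3" where
  "lorentz_e1 \<rho> p v =
     (frame_coords p v $ 1) *\<^sub>R (\<rho> *\<^sub>R heis_e2 p + heis_e3 p)
     + (frame_coords p v $ 2) *\<^sub>R (- \<rho> *\<^sub>R heis_e1 p)
     + (frame_coords p v $ 3) *\<^sub>R (- heis_e1 p)"

lemma lorentz_e1_frame:
  "lorentz_e1 \<rho> p (heis_e1 p) = \<rho> *\<^sub>R heis_e2 p + heis_e3 p"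
  "lorentz_e1 \<rho> p (heis_e2 p) = - \<rho> *\<^sub>R heis_e1 p"
  "lorentz_e1 \<rho> p (heis_e3 p) = - heis_e1 p"
  by (simp_all add: lorentz_e1_def frame_coords_def heis_e_defs vec_eq_iff forall_3)

definition magnetic_trajectory ::
    "(real^3 \<Rightarrow> real^3 \<Rightarrow> real^3) \<Rightarrow> (real \<Rightarrow> real^3) \<Rightarrow> bool" where
  "magnetic_trajectory F \<gamma> \<longleftrightarrow> smooth_curve \<gamma> \<and>
     (\<forall>t. covariant_acceleration heis_metric \<gamma> t = F (\<gamma> t) (velocity \<gamma> t))"

definition energy :: "(real \<Rightarrow> real^3) \<Rightarrow> real" where
  "energy \<gamma> = heis_metric (\<gamma> 0) (velocity \<gamma> 0) (velocity \<gamma> 0) / 2"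

definition lambda_periodic :: "real^3 \<Rightarrow> (real \<Rightarrow> real^3) \<Rightarrow> bool" where
  "lambda_periodic lam \<sigma> \<longleftrightarrow> (\<exists>\<omega>. \<omega> \<noteq> 0 \<and> (\<forall>t. heis_mult lam (\<sigma> t) = \<sigma> (t + \<omega>)))"

end

theory Submission
  imports Defs
begin

text \<open>In the left-invariant frame the velocity \<open>(a, b, c)\<close> of a magnetic trajectory satisfies
  \<open>a' = - b c - \<rho> b - c\<close>, \<open>b' = a (c + \<rho>)\<close> and \<open>c' = a = x'\<close>. Hence \<open>k = c - x\<close> and
  \<open>z + x y / 2 + a + (\<rho> + k) y\<close> are constant along it. As \<open>(a, b, c)\<close> is unchanged by left
  translations, comparing these constants at \<open>t\<close> and \<open>t + \<omega>\<close> gives \<open>x\<^sub>1 = 0\<close> and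
  \<open>z\<^sub>1 + (\<rho> + k) y\<^sub>1 = 0\<close>, so that \<open>y\<^sub>1 = 0\<close> would force \<open>\<lambda>\<close> to be the identity. Conversely the
  frame velocity \<open>(0, b, c)\<close> is stationary as soon as \<open>b (c + \<rho>) + c = 0\<close>; the intermediate value
  theorem yields such \<open>b > 0\<close> and \<open>c\<close> with \<open>b\<^sup>2 + c\<^sup>2 = 2 \<E>\<close>, and the abscissa of the resulting
  straight line can be chosen so that it is \<open>\<lambda>\<close>-periodic.\<close>

section \<open>The Levi-Civita connection\<close>

lemma partial_eqI: "(f has_derivative f') (at p) \<Longrightarrow> partial i f p = f' (axis i 1)"
  by (simp add: partial_def frechet_derivative_at[symmetric])

lemma gram_heis_metric:
  "gram heis_metric p = vector
     [vector [1 + (p$2)\<^sup>2 / 4, - (p$1 * p$2) / 4, p$2 / 2],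
      vector [- (p$1 * p$2) / 4, 1 + (p$1)\<^sup>2 / 4, - (p$1) / 2],
      vector [p$2 / 2, - (p$1) / 2, 1]]"
  by (simp add: gram_def vec_eq_iff forall_3 heis_metric_def frame_coords_def inner_vec_def sum_3
      axis_def power2_eq_square)

lemma matrix_inv_unique:
  fixes A :: "'a::semiring_1^'n^'m"
  assumes "A ** B = mat 1" "B ** A = mat 1"
  shows "matrix_inv A = B"
proof -
  have "A ** matrix_inv A = mat 1 \<and> matrix_inv A ** A = mat 1"
    unfolding matrix_inv_def by (rule someI[of _ B]) (use assms in simp)
  then show ?thesis
    using assms(1) by (metis matrix_mul_assoc matrix_mul_lid matrix_mul_rid)
qed

text \<open>The frame e_1, e_2, e_3 is orthonormal, so the inverse Gram matrix is the sum of the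
  matrices e_i e_i^T in chart coordinates.\<close>

lemma matrix_inv_gram_heis_metric:
  "matrix_inv (gram heis_metric p) = vector
     [vector [1, 0, - (p$2) / 2],
      vector [0, 1, p$1 / 2],
      vector [- (p$2) / 2, p$1 / 2, 1 + ((p$1)\<^sup>2 + (p$2)\<^sup>2) / 4]]"
  (is "_ = ?B")
proof (rule matrix_inv_unique)
  show "gram heis_metric p ** ?B = mat 1" "?B ** gram heis_metric p = mat 1"
    by (simp_all add: gram_heis_metric vec_eq_iff forall_3 matrix_matrix_mult_def sum_3 mat_def
        power2_eq_square field_simps)
qed

lemma partial_gram_heis_metric:
  fixes k :: 3
  shows
    "partial k (\<lambda>q. gram heis_metric q $ 1 $ 1) p = axis k 1 $ 2 * p$2 / 2"
    "partial k (\<lambda>q. gram heis_metric q $ 1 $ 2) p = - (axis k 1 $ 1 * p$2 + p$1 * axis k 1 $ 2) / 4"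
    "partial k (\<lambda>q. gram heis_metric q $ 1 $ 3) p = axis k 1 $ 2 / 2"
    "partial k (\<lambda>q. gram heis_metric q $ 2 $ 1) p = - (axis k 1 $ 1 * p$2 + p$1 * axis k 1 $ 2) / 4"
    "partial k (\<lambda>q. gram heis_metric q $ 2 $ 2) p = axis k 1 $ 1 * p$1 / 2"
    "partial k (\<lambda>q. gram heis_metric q $ 2 $ 3) p = - (axis k 1 $ 1) / 2"
    "partial k (\<lambda>q. gram heis_metric q $ 3 $ 1) p = axis k 1 $ 2 / 2"
    "partial k (\<lambda>q. gram heis_metric q $ 3 $ 2) p = - (axis k 1 $ 1) / 2"
    "partial k (\<lambda>q. gram heis_metric q $ 3 $ 3) p = 0"
proof -
  have nth: "((\<lambda>q::real^3. q $ i) has_derivative (\<lambda>h. h $ i)) (at p)" for i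
    by (rule bounded_linear_imp_has_derivative[OF bounded_linear_vec_nth])
  \<comment> \<open>Each Gram entry is constant, a multiple of one coordinate, or a constant plus a
    multiple of a product of two coordinates, so three rules cover all nine.\<close>
  have lin: "partial k (\<lambda>q::real^3. s * q $ i) p = s * axis k 1 $ i" for s i
    by (rule partial_eqI[OF has_derivative_mult_right[OF nth]])
  have quad: "partial k (\<lambda>q::real^3. r + s * (q $ i * q $ j)) p
      = s * (p $ i * axis k 1 $ j + axis k 1 $ i * p $ j)" for r s i j
    by (rule partial_eqI[THEN trans], rule has_derivative_add[OF has_derivative_const],
        rule has_derivative_mult_right[OF has_derivative_mult[OF nth nth]]) simp
  have const: "partial k (\<lambda>q::real^3. r) p = 0" for r
    by (rule partial_eqI[OF has_derivative_const])
  show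
    "partial k (\<lambda>q. gram heis_metric q $ 1 $ 1) p = axis k 1 $ 2 * p$2 / 2"
    "partial k (\<lambda>q. gram heis_metric q $ 1 $ 2) p = - (axis k 1 $ 1 * p$2 + p$1 * axis k 1 $ 2) / 4"
    "partial k (\<lambda>q. gram heis_metric q $ 1 $ 3) p = axis k 1 $ 2 / 2"
    "partial k (\<lambda>q. gram heis_metric q $ 2 $ 1) p = - (axis k 1 $ 1 * p$2 + p$1 * axis k 1 $ 2) / 4"
    "partial k (\<lambda>q. gram heis_metric q $ 2 $ 2) p = axis k 1 $ 1 * p$1 / 2"
    "partial k (\<lambda>q. gram heis_metric q $ 2 $ 3) p = - (axis k 1 $ 1) / 2"
    "partial k (\<lambda>q. gram heis_metric q $ 3 $ 1) p = axis k 1 $ 2 / 2"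
    "partial k (\<lambda>q. gram heis_metric q $ 3 $ 2) p = - (axis k 1 $ 1) / 2"
    "partial k (\<lambda>q. gram heis_metric q $ 3 $ 3) p = 0"
    using lin[of "1/2" 2] lin[of "-1/2" 1] quad[of 1 "1/4" 2 2] quad[of 1 "1/4" 1 1]
      quad[of 0 "-1/4" 1 2] const[of 1]
    by (simp_all add: gram_heis_metric power2_eq_square field_simps)
qed

text \<open>The metric is dx^2 + dy^2 + \<theta>^2 with \<theta> = dz + (y dx - x dy) / 2. The
  Christoffel terms come from d\<theta> = - dx \<and> dy, hence a quarter turn of the horizontal
  velocity scaled by c = \<theta>(\<gamma>'); the last entry is the one that keeps \<open>c\<close>
  constant along geodesics.\<close>

lemma covariant_acceleration_heis_metric:
  fixes \<gamma> :: "real \<Rightarrow> real^3"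
  defines "v \<equiv> velocity \<gamma>" and "w \<equiv> velocity (velocity \<gamma>)"
    and "c \<equiv> \<lambda>t. frame_coords (\<gamma> t) (velocity \<gamma> t) $ 3"
  shows "covariant_acceleration heis_metric \<gamma> t =
    w t + c t *\<^sub>R vector [v t $ 2, - (v t $ 1), - (\<gamma> t $ 2 * v t $ 2 + \<gamma> t $ 1 * v t $ 1) / 2]"
  unfolding covariant_acceleration_def christoffel_def v_def w_def c_def
  by (simp add: vec_eq_iff forall_3 sum_3 matrix_inv_gram_heis_metric partial_gram_heis_metric
      axis_def frame_coords_def)
     (simp add: field_simps power2_eq_square)

section \<open>The magnetic equation in the left-invariant frame\<close>

lemma frame_coords_nth: "frame_coords p v $ 1 = v $ 1" "frame_coords p v $ 2 = v $ 2"
  by (simp_all add: frame_coords_def)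

text \<open>For a smooth curve the third equation says c' = a: differentiating the base point inside
  \<open>c\<close> only adds (y' x' - x' y') / 2 = 0.\<close>

lemma magnetic_equation_iff:
  fixes \<gamma> :: "real \<Rightarrow> real^3"
  defines "a \<equiv> \<lambda>t. velocity \<gamma> t $ 1" and "b \<equiv> \<lambda>t. velocity \<gamma> t $ 2"
    and "c \<equiv> \<lambda>t. frame_coords (\<gamma> t) (velocity \<gamma> t) $ 3"
    and "w \<equiv> velocity (velocity \<gamma>)"
  shows "covariant_acceleration heis_metric \<gamma> t = lorentz_e1 \<rho> (\<gamma> t) (velocity \<gamma> t) \<longleftrightarrow>
     w t $ 1 = - b t * c t - \<rho> * b t - c t \<and> w t $ 2 = a t * (c t + \<rho>) \<and>
     frame_coords (\<gamma> t) (w t) $ 3 = a t"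
proof -
  \<comment> \<open>Given the two horizontal equations, the chart equation for z is equivalent to
    the one for the e_3 component.\<close>
  have eq3: "u3 - (p2 * b + p1 * a) * c / 2 = p2 * (\<rho> * b + c) / 2 + p1 * \<rho> * a / 2 + a \<longleftrightarrow>
      u3 + (p2 * u1 - p1 * u2) / 2 = a"
    if "u1 = - b * c - \<rho> * b - c" "u2 = a * (c + \<rho>)" for a b c p1 p2 u1 u2 u3 :: real
    unfolding that by (simp add: field_simps) linarith
  have "covariant_acceleration heis_metric \<gamma> t = lorentz_e1 \<rho> (\<gamma> t) (velocity \<gamma> t) \<longleftrightarrow>
     w t $ 1 = - b t * c t - \<rho> * b t - c t \<and> w t $ 2 = a t * (c t + \<rho>) \<and>
     w t $ 3 - (\<gamma> t $ 2 * b t + \<gamma> t $ 1 * a t) * c t / 2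
       = \<gamma> t $ 2 * (\<rho> * b t + c t) / 2 + \<gamma> t $ 1 * \<rho> * a t / 2 + a t"
    unfolding covariant_acceleration_heis_metric lorentz_e1_def a_def b_def c_def w_def
    by (simp add: vec_eq_iff forall_3 heis_e_defs frame_coords_nth)
       (simp add: field_simps, argo)
  then show ?thesis
    using eq3[of "w t $ 1" "b t" "c t" "w t $ 2" "a t" "w t $ 3" "\<gamma> t $ 2" "\<gamma> t $ 1"]
    by (auto simp: frame_coords_def)
qed

section \<open>Periodic trajectories\<close>

lemma velocity_nth:
  fixes \<gamma> :: "real \<Rightarrow> real^'n"
  assumes "\<gamma> differentiable (at t)"
  shows "((\<lambda>t. \<gamma> t $ i) has_real_derivative velocity \<gamma> t $ i) (at t)"
proof -
  have "(\<gamma> has_vector_derivative velocity \<gamma> t) (at t)"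
    using assms by (simp add: velocity_def vector_derivative_works)
  from bounded_linear.has_vector_derivative[OF bounded_linear_vec_nth this]
  show ?thesis by (simp add: has_real_derivative_iff_has_vector_derivative)
qed

lemma velocity_eqI: "(\<gamma> has_vector_derivative v) (at t) \<Longrightarrow> velocity \<gamma> t = v"
  by (simp add: velocity_def vector_derivative_at)

lemma velocity_affine: "velocity (\<lambda>t. p + t *\<^sub>R v) = (\<lambda>t. v)"
  by (rule ext, rule velocity_eqI) (auto intro!: derivative_eq_intros)

lemma velocity_const: "velocity (\<lambda>t. p) = (\<lambda>t. 0)"
  by (rule ext, rule velocity_eqI) (auto intro!: derivative_eq_intros)

lemma smooth_curve_affine:
  fixes p v :: "'a::real_normed_vector"
  shows "smooth_curve (\<lambda>t. p + t *\<^sub>R v)"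
proof -
  have "\<exists>q u. (velocity ^^ n) (\<lambda>t. p + t *\<^sub>R v) = (\<lambda>t. q + t *\<^sub>R u)" for n
  proof (induction n)
    case (Suc n)
    then obtain q u where "(velocity ^^ n) (\<lambda>t. p + t *\<^sub>R v) = (\<lambda>t. q + t *\<^sub>R u)" by blast
    then have "(velocity ^^ Suc n) (\<lambda>t. p + t *\<^sub>R v) = (\<lambda>t. u + t *\<^sub>R 0)"
      by (simp add: velocity_affine)
    then show ?case by blast
  qed auto
  moreover have "(\<lambda>t. q + t *\<^sub>R u) differentiable (at t)" for q u :: 'a and t
    by simp
  ultimately show ?thesis
    unfolding smooth_curve_def by metis
qed

section \<open>Conserved quantities and nonexistence\<close>

lemma frame_velocity_periodic:
  assumes per: "\<And>t. heis_mult lam (\<gamma> t) = \<gamma> (t + \<omega>)"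
    and diff: "\<And>t. \<gamma> differentiable (at t)"
  shows "frame_coords (\<gamma> (t + \<omega>)) (velocity \<gamma> (t + \<omega>)) = frame_coords (\<gamma> t) (velocity \<gamma> t)"
proof -
  have g: "(\<gamma> has_vector_derivative velocity \<gamma> s) (at s)" for s
    using diff by (simp add: velocity_def vector_derivative_works)
  \<comment> \<open>The derivative of the shifted curve is computed twice, by the time shift and by
    left translation with differential \<open>D\<close>; \<open>D\<close> preserves the
    frame.\<close>
  have 1: "((\<lambda>s. \<gamma> (s + \<omega>)) has_vector_derivative velocity \<gamma> (t + \<omega>)) (at t)"
    using vector_diff_chain_at[of "\<lambda>s. s + \<omega>" 1 t \<gamma> "velocity \<gamma> (t + \<omega>)"] g[of "t + \<omega>"]
    by (simp add: o_def has_vector_derivative_add_const)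
  define D :: "real^3 \<Rightarrow> real^3"
    where "D = (\<lambda>v. vector [v$1, v$2, v$3 + (lam$1 * v$2 - v$1 * lam$2) / 2])"
  have D: "(heis_mult lam has_derivative D) (at p)" for p
    unfolding D_def by (rule heis_mult_has_derivative)
  then have "bounded_linear D"
    by (rule has_derivative_bounded_linear)
  then have "D (s *\<^sub>R u) = s *\<^sub>R D u" for s u
    by (rule linear_simps)
  with has_derivative_compose[OF g[of t, unfolded has_vector_derivative_def] D]
  have "((\<lambda>s. heis_mult lam (\<gamma> s)) has_vector_derivative D (velocity \<gamma> t)) (at t)"
    by (simp add: has_vector_derivative_def)
  then have v: "velocity \<gamma> (t + \<omega>) = D (velocity \<gamma> t)"
    using 1 by (auto simp: per intro: vector_derivative_unique_at)
  show ?thesis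
    unfolding v per[symmetric]
    by (simp add: D_def frame_coords_def heis_mult_nth vec_eq_iff forall_3 field_simps)
qed

text \<open>Since c' = x', \<open>c\<close> can be replaced by k + x in the product b c. With the
  remaining linear \<open>c\<close> expanded by its definition, the equation for a' becomes a total
  derivative, as x y' + (y x' - x y') / 2 = (x y)' / 2.\<close>

lemma magnetic_trajectory_first_integrals:
  fixes \<gamma> :: "real \<Rightarrow> real^3"
  defines "c \<equiv> \<lambda>t. frame_coords (\<gamma> t) (velocity \<gamma> t) $ 3"
  assumes "magnetic_trajectory (lorentz_e1 \<rho>) \<gamma>"
  obtains k m where "\<And>t. c t - \<gamma> t $ 1 = k"
    "\<And>t. \<gamma> t $ 3 + \<gamma> t $ 1 * \<gamma> t $ 2 / 2 + velocity \<gamma> t $ 1 + (\<rho> + k) * \<gamma> t $ 2 = m"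
proof -
  have sm: "(velocity ^^ n) \<gamma> differentiable (at t)" for n t
    using assms by (simp add: magnetic_trajectory_def smooth_curve_def)
  note d = velocity_nth[OF sm[of 0, simplified]] and e = velocity_nth[OF sm[of 1, simplified]]
  define w where "w = velocity (velocity \<gamma>)"
  have eq: "w t $ 1 = - velocity \<gamma> t $ 2 * c t - \<rho> * velocity \<gamma> t $ 2 - c t"
      "frame_coords (\<gamma> t) (w t) $ 3 = velocity \<gamma> t $ 1" for t
    using assms(2) unfolding magnetic_trajectory_def magnetic_equation_iff c_def w_def by auto
  have "((\<lambda>t. c t - \<gamma> t $ 1) has_real_derivative 0) (at t)" for t
    unfolding c_def frame_coords_def vector_3
    by (rule DERIV_cong[OF DERIV_diff[OF DERIV_add[OF e
          DERIV_cdivide[OF DERIV_diff[OF DERIV_mult[OF d e] DERIV_mult[OF d e]]]] d]])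
       (use eq(2)[of t] in \<open>simp add: frame_coords_def w_def field_simps\<close>)
  then have "c t - \<gamma> t $ 1 = c 0 - \<gamma> 0 $ 1" for t
    by (intro DERIV_isconst_all[of "\<lambda>t. c t - \<gamma> t $ 1"]) blast
  then obtain k where k: "\<And>t. c t - \<gamma> t $ 1 = k"
    by blast
  let ?G = "\<lambda>t. \<gamma> t $ 3 + \<gamma> t $ 1 * \<gamma> t $ 2 / 2 + velocity \<gamma> t $ 1 + (\<rho> + k) * \<gamma> t $ 2"
  have "(?G has_real_derivative 0) (at t)" for t
  proof -
    have c: "c t = velocity \<gamma> t $ 3 + (\<gamma> t $ 2 * velocity \<gamma> t $ 1 - \<gamma> t $ 1 * velocity \<gamma> t $ 2) / 2"
      by (simp add: c_def frame_coords_def)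
    have w: "w t $ 1 = - velocity \<gamma> t $ 2 * (k + \<gamma> t $ 1) - \<rho> * velocity \<gamma> t $ 2 - c t"
      using eq(1)[of t] k[of t] by (simp add: algebra_simps)
    show ?thesis
      by (rule DERIV_cong[OF DERIV_add[OF DERIV_add[OF DERIV_add[OF d
            DERIV_cdivide[OF DERIV_mult[OF d d]]] e] DERIV_cmult[OF d]]])
         (use w c in \<open>simp add: w_def field_simps\<close>)
  qed
  then have "?G t = ?G 0" for t
    by (intro DERIV_isconst_all[of ?G]) blast
  with k show ?thesis by (rule that)
qed

lemma lambda_periodic_magnetic_trajectory:
  assumes "magnetic_trajectory (lorentz_e1 \<rho>) \<gamma>" "lambda_periodic lam \<gamma>"
  shows "lam $ 1 = 0" "lam $ 2 = 0 \<Longrightarrow> lam = 0"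
proof -
  obtain \<omega> where per: "heis_mult lam (\<gamma> t) = \<gamma> (t + \<omega>)" for t
    using assms(2) by (auto simp: lambda_periodic_def)
  have diff: "\<gamma> differentiable (at t)" for t
    using assms(1) funpow_0[of velocity \<gamma>]
    unfolding magnetic_trajectory_def smooth_curve_def by metis
  have shift: "frame_coords (\<gamma> \<omega>) (velocity \<gamma> \<omega>) = frame_coords (\<gamma> 0) (velocity \<gamma> 0)"
    using frame_velocity_periodic[OF per diff, of 0] by simp
  then have v1: "velocity \<gamma> \<omega> $ 1 = velocity \<gamma> 0 $ 1"
    by (simp add: frame_coords_def vec_eq_iff forall_3)
  have \<omega>: "\<gamma> \<omega> = heis_mult lam (\<gamma> 0)"
    using per[of 0] by simp
  obtain k m where 1: "\<And>t. frame_coords (\<gamma> t) (velocity \<gamma> t) $ 3 - \<gamma> t $ 1 = k"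
    and 2: "\<And>t. \<gamma> t $ 3 + \<gamma> t $ 1 * \<gamma> t $ 2 / 2 + velocity \<gamma> t $ 1 + (\<rho> + k) * \<gamma> t $ 2 = m"
    using magnetic_trajectory_first_integrals[OF assms(1)] by blast
  \<comment> \<open>Over one period \<open>c\<close> returns to its value while x grows by
    \<open>lam $ 1\<close>.\<close>
  show x: "lam $ 1 = 0"
    using 1[of \<omega>] 1[of 0] unfolding shift by (simp add: \<omega> heis_mult_nth)
  \<comment> \<open>Now translation by \<open>lam\<close> moves only z, by \<open>lam $ 3\<close>,
    and the second first integral forbids this.\<close>
  show "lam = 0" if "lam $ 2 = 0"
    using 2[of \<omega>] 2[of 0] x that by (simp add: v1 \<omega> heis_mult_nth vec_eq_iff forall_3)
qed

section \<open>Straight-line trajectories of prescribed energy\<close>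

lemma stationary_frame_velocity:
  fixes E \<rho> :: real
  assumes "E > 0"
  obtains b c where "b > 0" "b * (c + \<rho>) + c = 0" "b\<^sup>2 + c\<^sup>2 = 2 * E"
proof -
  \<comment> \<open>Solving the linear relation gives c = - \<rho> b / (1 + b), leaving one equation
    in b. \<open>?f\<close> vanishes at 0 and is at least 2 E at
    \<open>sqrt (2 * E)\<close>.\<close>
  let ?f = "\<lambda>b. b\<^sup>2 + (- \<rho> * b / (1 + b))\<^sup>2"
  have "\<exists>b\<ge>0. b \<le> sqrt (2 * E) \<and> ?f b = 2 * E"
    by (rule IVT') (use assms in \<open>auto intro!: continuous_intros\<close>)
  then obtain b where b: "b \<ge> 0" "?f b = 2 * E" by blast
  with assms have "b \<noteq> 0" by auto
  with b have "b > 0" by simp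
  then show ?thesis
    by (intro that[of b "- \<rho> * b / (1 + b)"]) (use b in \<open>auto simp: field_simps\<close>)
qed

lemma exists_lambda_periodic_magnetic_trajectory:
  assumes "E > 0" "lam $ 1 = 0" "lam $ 2 \<noteq> 0"
  shows "\<exists>\<gamma>. magnetic_trajectory (lorentz_e1 \<rho>) \<gamma> \<and> lambda_periodic lam \<gamma> \<and> energy \<gamma> = E"
proof -
  obtain b c where b: "b > 0" and bc: "b * (c + \<rho>) + c = 0" and E: "b\<^sup>2 + c\<^sup>2 = 2 * E"
    using stationary_frame_velocity[OF assms(1)] .
  \<comment> \<open>The y coordinate forces the period \<open>lam $ 2 / b\<close>; matching z then
    reads lam_3 = lam_2 (x + c / b).\<close>
  define x where "x = lam $ 3 / lam $ 2 - c / b"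
  define p :: "real^3" where "p = vector [x, 0, 0]"
  \<comment> \<open>The summand x b / 2 makes the third frame coordinate equal to \<open>c\<close>;
    x is constant on the line, so the frame velocity stays (0, b, c).\<close>
  define v :: "real^3" where "v = vector [0, b, c + x * b / 2]"
  define \<gamma> where "\<gamma> = (\<lambda>t. p + t *\<^sub>R v)"
  note vel = velocity_affine[of p v, folded \<gamma>_def]
  have "magnetic_trajectory (lorentz_e1 \<rho>) \<gamma>"
    unfolding magnetic_trajectory_def magnetic_equation_iff
    using smooth_curve_affine[of p v] bc
    by (simp add: vel velocity_const flip: \<gamma>_def)
       (simp add: \<gamma>_def p_def v_def frame_coords_def algebra_simps)
  moreover have "lambda_periodic lam \<gamma>"
    unfolding lambda_periodic_def
  proof (intro exI[of _ "lam $ 2 / b"] conjI allI)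
    show "heis_mult lam (\<gamma> t) = \<gamma> (t + lam $ 2 / b)" for t
      using assms b
      by (simp add: \<gamma>_def p_def v_def x_def heis_mult_nth vec_eq_iff forall_3 field_simps)
  qed (use assms b in auto)
  moreover have "energy \<gamma> = E"
    using E by (simp add: energy_def vel heis_metric_def)
      (simp add: \<gamma>_def p_def v_def frame_coords_def inner_vec_def sum_3 power2_eq_square)
  ultimately show ?thesis by blast
qed

theorem proposition4p8:
  fixes \<rho> x1 y1 z1 E :: real and lam :: "real^3"
  assumes "\<rho> \<noteq> 0"
    and "(x1, y1, z1) \<noteq> (0, 0, 0)"
    and "lam = heis_exp (\<lambda>p. x1 *\<^sub>R heis_e1 p + y1 *\<^sub>R heis_e2 p + z1 *\<^sub>R heis_e3 p)"
    and "E > 0"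
  shows "((x1 \<noteq> 0 \<or> y1 = 0) \<longrightarrow>
           \<not> (\<exists>\<gamma>. magnetic_trajectory (lorentz_e1 \<rho>) \<gamma> \<and> lambda_periodic lam \<gamma>))
       \<and> ((x1 = 0 \<and> y1 \<noteq> 0) \<longrightarrow>
           (\<exists>\<gamma>. magnetic_trajectory (lorentz_e1 \<rho>) \<gamma> \<and> lambda_periodic lam \<gamma> \<and> energy \<gamma> = E))"
proof -
  have lam: "lam = vector [x1, y1, z1]"
    using assms(3) by (simp add: heis_exp_eq)
  show ?thesis
    using lambda_periodic_magnetic_trajectory[of \<rho> _ lam]
      exists_lambda_periodic_magnetic_trajectory[OF assms(4), of lam \<rho>] assms(2)
    by (auto simp: lam vec_eq_iff forall_3)
qed

end
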